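(* For arbitrary $n\ge0$, the function $$\operatorname{HS}_n:=\operatorname{sign}(Y)\,|Y|^{\exp\left(n\left(H_{diag}-H\right)\right)}$$ on $\mathbb{T}$ is a measure of association.
   Context: $\mathbb{T}$ is the set of real $2\times2$ matrices $t=\begin{pmatrix}p_{00}&p_{01}\\ p_{10}&p_{11}\end{pmatrix}$ with all $p_{ij}>0$ and $\sum_{i,j}p_{ij}=1$. The margins are $p_{i.}=p_{i0}+p_{i1}$ and $p_{.j}=p_{0j}+p_{1j}$. The odds-ratio is $\lambda(t)=\frac{p_{00}p_{11}}{p_{01}p_{10}}$, and Yule's $Y$ is $Y=\frac{\sqrt\lambda-1}{\sqrt\lambda+1}$. The entropy is $H(t)=-\sum_{i,j}p_{ij}\log_2p_{ij}$, and $H_{diag}(t)$ is the entropy of the diagonal table of the same odds-ratio as $t$, namely $\frac{1}{2(1+\sqrt\lambda)}\begin{pmatrix}\sqrt\lambda&1\\1&\sqrt\lambda\end{pmatrix}$ with $\lambda=\lambda(t)$. A measure of association is a continuous function $\eta:\mathbb{T}\to\mathbb{R}$ such that: a) $\eta$ is zero on independent tables (tables with $p_{ij}=p_{i.}p_{.j}$ for all $i,j$); b) $\eta$ is a strictly increasing function of the odds-ratio when restricted to tables with fixed margins; c1) $\eta$ is invariant under matrix transposition; c2) $\eta$ changes sign when the two rows are exchanged and when the two columns are exchanged. *)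

theory Defs
  imports "HOL-Analysis.Analysis"
begin

text \<open>
  Rows and columns are indexed by the numeral type \<^typ>\<open>2\<close>, whose two elements are
  \<open>0\<close> and \<open>1\<close> (with \<open>2 = 0\<close>), so \<open>t $ i $ j\<close> is the entry \<open>p\<^sub>i\<^sub>j\<close> of the table \<open>t\<close>.
\<close>

type_synonym table = "real^2^2"

definition tables :: "table set" where
  "tables = {t. (\<forall>i j. t $ i $ j > 0) \<and> (\<Sum>i\<in>UNIV. \<Sum>j\<in>UNIV. t $ i $ j) = 1}"

definition row_margin :: "table \<Rightarrow> 2 \<Rightarrow> real" where
  "row_margin t i = t $ i $ 0 + t $ i $ 1"

definition col_margin :: "table \<Rightarrow> 2 \<Rightarrow> real" where
  "col_margin t j = t $ 0 $ j + t $ 1 $ j"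

definition independent_table :: "table \<Rightarrow> bool" where
  "independent_table t \<longleftrightarrow> (\<forall>i j. t $ i $ j = row_margin t i * col_margin t j)"

definition odds_ratio :: "table \<Rightarrow> real" where
  "odds_ratio t = (t $ 0 $ 0 * t $ 1 $ 1) / (t $ 0 $ 1 * t $ 1 $ 0)"

definition yule_Y :: "table \<Rightarrow> real" where
  "yule_Y t = (sqrt (odds_ratio t) - 1) / (sqrt (odds_ratio t) + 1)"

definition table_entropy :: "table \<Rightarrow> real" where
  "table_entropy t = - (\<Sum>i\<in>UNIV. \<Sum>j\<in>UNIV. t $ i $ j * log 2 (t $ i $ j))"

definition diag_table :: "real \<Rightarrow> table" where
  "diag_table l = (\<chi> i j. (if i = j then sqrt l else 1) / (2 * (1 + sqrt l)))"

definition diag_entropy :: "table \<Rightarrow> real" where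
  "diag_entropy t = table_entropy (diag_table (odds_ratio t))"

text \<open>On the index type \<^typ>\<open>2\<close>, the map \<open>i \<mapsto> 1 - i\<close> exchanges \<open>0\<close> and \<open>1\<close>.\<close>

definition swap_rows :: "table \<Rightarrow> table" where
  "swap_rows t = (\<chi> i j. t $ (1 - i) $ j)"

definition swap_cols :: "table \<Rightarrow> table" where
  "swap_cols t = (\<chi> i j. t $ i $ (1 - j))"

definition tables_with_margins :: "(2 \<Rightarrow> real) \<Rightarrow> (2 \<Rightarrow> real) \<Rightarrow> table set" where
  "tables_with_margins r c = {t \<in> tables. row_margin t = r \<and> col_margin t = c}"

text \<open>
  A function on the set of tables is a total function of which only the values on
  \<^const>\<open>tables\<close> matter.
\<close>

definition measure_of_association :: "(table \<Rightarrow> real) \<Rightarrow> bool" where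
  "measure_of_association \<eta> \<longleftrightarrow>
     continuous_on tables \<eta> \<and>
     (\<forall>t\<in>tables. independent_table t \<longrightarrow> \<eta> t = 0) \<and>
     (\<forall>r c. \<exists>f. strict_mono_on (odds_ratio ` tables_with_margins r c) f \<and>
        (\<forall>t\<in>tables_with_margins r c. \<eta> t = f (odds_ratio t))) \<and>
     (\<forall>t\<in>tables. \<eta> (transpose t) = \<eta> t) \<and>
     (\<forall>t\<in>tables. \<eta> (swap_rows t) = - \<eta> t) \<and>
     (\<forall>t\<in>tables. \<eta> (swap_cols t) = - \<eta> t)"

definition HS :: "real \<Rightarrow> table \<Rightarrow> real" where
  "HS n t = sgn (yule_Y t) * \<bar>yule_Y t\<bar> powr exp (n * (diag_entropy t - table_entropy t))"

end

theory Submission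
  imports Defs
begin

text \<open>
  Fix the margins and move \<open>p\<^sub>0\<^sub>0\<close>; the entropy (in nats) then has derivative \<open>- ln \<lambda>\<close>. The diagonal
  tables are themselves a family with fixed margins, so the derivative of \<open>H\<^sub>d\<^sub>i\<^sub>a\<^sub>g - H\<close> is
  \<open>ln \<lambda>\<close> times one minus the speed of the diagonal table. Since \<open>ln \<lambda>\<close> has derivative
  \<open>S = \<Sum> 1 / p\<^sub>i\<^sub>j\<close> along both families, and since the diagonal table minimises \<open>S\<close> among the tables with
  a given odds-ratio \<open>\<lambda> \<ge> 1\<close>, this speed is at least one. Hence \<open>H\<^sub>d\<^sub>i\<^sub>a\<^sub>g - H\<close> decreases in
  \<open>\<lambda> \<ge> 1\<close>, so that \<open>Y\<close>, which is less than 1, is raised to ever smaller powers. Exchanging the rows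
  reduces \<open>\<lambda> \<le> 1\<close> to this case.
\<close>

section \<open>Tables in coordinates\<close>

lemma UNIV_two: "(UNIV :: 2 set) = {0, 1}"
proof -
  have "(i :: 2) = 0 \<or> i = 1" for i
    using exhaust_2[of i] by auto
  then show ?thesis by auto
qed

lemma all_two: "(\<forall>i::2. P i) \<longleftrightarrow> P 0 \<and> P 1"
  using UNIV_two by (metis UNIV_I empty_iff insert_iff)

lemma sum_two: "(\<Sum>i\<in>(UNIV :: 2 set). f i) = f 0 + (f 1 :: real)"
  by (simp add: UNIV_two)

lemma minus_two [simp]: "(1 :: 2) - 0 = 1" "(1 :: 2) - 1 = 0"
  by simp_all

lemma tables_iff:
  "t \<in> tables \<longleftrightarrow> t$0$0 > 0 \<and> t$0$1 > 0 \<and> t$1$0 > 0 \<and> t$1$1 > 0 \<and>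
     t$0$0 + t$0$1 + t$1$0 + t$1$1 = 1"
  by (auto simp: tables_def all_two sum_two)

lemma table_eq_iff:
  "(t :: table) = t' \<longleftrightarrow>
     t$0$0 = t'$0$0 \<and> t$0$1 = t'$0$1 \<and> t$1$0 = t'$1$0 \<and> t$1$1 = t'$1$1"
  by (auto simp: vec_eq_iff all_two)

lemma table_entropy_eq:
  "table_entropy t = - (t$0$0 * ln (t$0$0) + t$0$1 * ln (t$0$1) +
     t$1$0 * ln (t$1$0) + t$1$1 * ln (t$1$1)) / ln 2"
  by (simp add: table_entropy_def sum_two log_def add_divide_distrib diff_divide_distrib)

lemma odds_ratio_pos: "t \<in> tables \<Longrightarrow> odds_ratio t > 0"
  by (simp add: odds_ratio_def tables_iff)

lemma diag_table_entropy:
  assumes "l > 0"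
  shows "table_entropy (diag_table l) =
    (ln (2 * (1 + sqrt l)) - sqrt l / (1 + sqrt l) * ln (sqrt l)) / ln 2"
proof -
  define s where "s = sqrt l"
  have s: "s > 0" using assms by (simp add: s_def)
  have nz: "2 + 2 * s \<noteq> 0" "1 + s \<noteq> 0" using s by auto
  have "table_entropy (diag_table l) =
      - (2 * (s / (2 * (1 + s))) * ln (s / (2 * (1 + s))) +
         2 * (1 / (2 * (1 + s))) * ln (1 / (2 * (1 + s)))) / ln 2"
    by (simp add: table_entropy_eq diag_table_def s_def)
  also have "ln (s / (2 * (1 + s))) = ln s - ln (2 * (1 + s))"
    using s by (simp add: ln_div)
  also have "ln (1 / (2 * (1 + s))) = - ln (2 * (1 + s))"
    using s by (simp add: ln_div)
  also have "- (2 * (s / (2 * (1 + s))) * (ln s - ln (2 * (1 + s))) +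
         2 * (1 / (2 * (1 + s))) * - ln (2 * (1 + s))) =
      ln (2 * (1 + s)) - s / (1 + s) * ln s"
  proof -
    have "- (2 * (s / (2 * (1 + s))) * (p - q) + 2 * (1 / (2 * (1 + s))) * - q) =
        q - s / (1 + s) * p" for p q
      using nz by (simp add: divide_simps) (simp add: algebra_simps)
    then show ?thesis .
  qed
  finally show ?thesis by (simp add: s_def)
qed

section \<open>The sum of reciprocals at a given odds-ratio\<close>

text \<open>AM-GM on the pairs \<open>a, d\<close> and \<open>b, c\<close>. Equality holds at the
  diagonal table, with entries \<open>s / (2 * (1 + s))\<close> and
  \<open>1 / (2 * (1 + s))\<close>, whose reciprocals add up to the right-hand side.\<close>

lemma sum_inverse_ge_diagonal:
  fixes a b c d s :: real
  assumes pos: "a > 0" "b > 0" "c > 0" "d > 0"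
    and sum: "a + b + c + d = 1" and s: "s \<ge> 1" and ad: "a * d = s\<^sup>2 * (b * c)"
  shows "1 / a + 1 / b + 1 / c + 1 / d \<ge> 4 * (1 + s)\<^sup>2 / s"
proof -
  define w where "w = sqrt (b * c)"
  define v where "v = b + c"
  define k where "k = 1 / w"
  have w: "w > 0" "w\<^sup>2 = b * c" using pos by (auto simp: w_def)
  have v: "v \<ge> 2 * w"
    using arith_geo_mean_sqrt[of b c] pos by (simp add: w_def v_def)
  have "sqrt (a * d) = s * w"
    using s w by (simp add: ad flip: w(2)) (simp add: real_sqrt_mult)
  then have "a + d \<ge> 2 * (s * w)"
    using arith_geo_mean_sqrt[of a d] pos by simp
  then have "2 * (1 + s) * w \<le> 1"
    using v sum by (simp add: v_def algebra_simps)
  then have k: "k \<ge> 2 * (1 + s)" "k > 0"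
    using w by (simp_all add: k_def field_simps)
  have r: "1 - 1 / s\<^sup>2 \<ge> 0" using s by (simp add: field_simps)
  have "1 / a + 1 / b + 1 / c + 1 / d = (a + d) / (a * d) + (b + c) / (b * c)"
    using pos by (simp add: field_simps)
  also have "\<dots> = (1 - v) / (s\<^sup>2 * w\<^sup>2) + v / w\<^sup>2"
    using sum by (simp add: ad w v_def algebra_simps flip: sum)
  \<comment> \<open>In this form both summands increase with \<open>k\<close> and
    \<open>k * v\<close>, because \<open>s \<ge> 1\<close> makes the last factor nonnegative. AM-GM
    bounds \<open>k\<close> and \<open>k * v\<close> from below, so the estimate goes term by
    term.\<close>
  also have "\<dots> = k\<^sup>2 / s\<^sup>2 + k * (k * v) * (1 - 1 / s\<^sup>2)"
    using s w(1) by (simp add: k_def field_simps power2_eq_square)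
  also have "\<dots> \<ge> (2 * (1 + s))\<^sup>2 / s\<^sup>2 + (2 * (1 + s)) * 2 * (1 - 1 / s\<^sup>2)"
  proof (intro add_mono divide_right_mono power_mono mult_mono)
    show "2 \<le> k * v" using v w(1) by (simp add: k_def field_simps)
  qed (use k s r v w(1) in \<open>auto intro!: mult_nonneg_nonneg\<close>)
  also have "(2 * (1 + s))\<^sup>2 / s\<^sup>2 + (2 * (1 + s)) * 2 * (1 - 1 / s\<^sup>2) = 4 * (1 + s)\<^sup>2 / s"
    using s by (simp add: field_simps power2_eq_square)
  finally show ?thesis .
qed

section \<open>The entropy difference along a family with fixed margins\<close>

text \<open>This is \<open>ln 2\<close> times the diagonal entropy minus the entropy. Here
  \<open>L\<close> is the logarithm of the odds-ratio and \<open>exp (L / 2)\<close> its square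
  root; unlike the odds-ratio, \<open>L\<close> is a sum of functions of single entries.\<close>

definition entropy_gap :: "real \<Rightarrow> real \<Rightarrow> real \<Rightarrow> real \<Rightarrow> real" where
  "entropy_gap a b c d =
     (let L = ln a + ln d - ln b - ln c in
       ln (2 * (1 + exp (L / 2))) - exp (L / 2) / (1 + exp (L / 2)) * (L / 2) +
       (a * ln a + b * ln b + c * ln c + d * ln d))"

lemma sqrt_odds_ratio:
  assumes "t \<in> tables"
  shows "sqrt (odds_ratio t) =
    exp ((ln (t$0$0) + ln (t$1$1) - ln (t$0$1) - ln (t$1$0)) / 2)"
proof -
  have "ln (t$0$0) + ln (t$1$1) - ln (t$0$1) - ln (t$1$0) = ln (odds_ratio t)"
    using assms by (simp add: tables_iff odds_ratio_def ln_mult ln_div)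
  then show ?thesis
    using odds_ratio_pos[OF assms] by (simp flip: ln_sqrt)
qed

lemma diag_entropy_diff:
  assumes "t \<in> tables"
  shows "diag_entropy t - table_entropy t =
    entropy_gap (t$0$0) (t$0$1) (t$1$0) (t$1$1) / ln 2"
proof -
  have "ln (sqrt (odds_ratio t)) =
      (ln (t$0$0) + ln (t$1$1) - ln (t$0$1) - ln (t$1$0)) / 2"
    by (simp only: sqrt_odds_ratio[OF assms] ln_exp)
  then show ?thesis
    unfolding diag_entropy_def diag_table_entropy[OF odds_ratio_pos[OF assms]]
      table_entropy_eq[of t] entropy_gap_def Let_def sqrt_odds_ratio[OF assms, symmetric]
    by (simp only: add_divide_distrib minus_divide_left[symmetric] diff_minus_eq_add)
qed

text \<open>The first \<open>L u\<close> comes from the entropy: the constants from differentiating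
  \<open>x * ln x\<close> cancel, since the four shifts add up to zero. The rest is the chain rule
  for the diagonal entropy \<open>G\<close> as a function of \<open>L\<close>, where
  \<open>L\<close> has the sum of reciprocals as derivative.\<close>

lemma entropy_gap_deriv:
  fixes a b c d u :: real
  assumes pos: "a + u > 0" "b - u > 0" "c - u > 0" "d + u > 0"
  defines "L \<equiv> \<lambda>u. ln (a + u) + ln (d + u) - ln (b - u) - ln (c - u)"
  shows "((\<lambda>u. entropy_gap (a + u) (b - u) (c - u) (d + u)) has_real_derivative
    L u - L u / 2 / (1 + exp (L u / 2))\<^sup>2 * (exp (L u / 2) *
      (1 / (a + u) + 1 / (b - u) + 1 / (c - u) + 1 / (d + u)) / 2)) (at u)"
proof -
  define S where "S = 1 / (a + u) + 1 / (b - u) + 1 / (c - u) + 1 / (d + u)"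
  define G where "G x = ln (2 * (1 + exp (x / 2))) - exp (x / 2) / (1 + exp (x / 2)) * (x / 2)"
    for x :: real
  have dL: "(L has_real_derivative S) (at u)"
    unfolding L_def S_def using pos
    by (auto intro!: derivative_eq_intros simp: divide_inverse)
  have dG: "(G has_real_derivative - (x / 2) / (1 + exp (x / 2))\<^sup>2 * (exp (x / 2) / 2)) (at x)" for x
  proof -
    define e where "e = exp (x / 2)"
    have e: "e > 0" by (simp add: e_def)
    have nz: "1 + e \<noteq> 0" "2 * (1 + e) > 0" using e by simp_all
    have "(G has_real_derivative 2 * (e / 2) / (2 * (1 + e)) -
        ((e / 2 * (1 + e) - e * (e / 2)) / ((1 + e) * (1 + e)) * (x / 2) + e / (1 + e) / 2)) (at x)"
      unfolding G_def e_def
      by (rule derivative_eq_intros refl nz[unfolded e_def] | simp)+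
    also have "2 * (e / 2) / (2 * (1 + e)) -
        ((e / 2 * (1 + e) - e * (e / 2)) / ((1 + e) * (1 + e)) * (x / 2) + e / (1 + e) / 2) =
        - (x / 2) / (1 + e)\<^sup>2 * (e / 2)"
    proof -
      have num: "e / 2 * (1 + e) - e * (e / 2) = e / 2" by (simp add: algebra_simps)
      have half: "2 * (e / 2) / (2 * (1 + e)) = e / (1 + e) / 2"
        using nz by (simp add: field_simps)
      show ?thesis unfolding num half power2_eq_square by simp
    qed
    finally show ?thesis by (simp add: e_def)
  qed
  have "((\<lambda>u. G (L u) + ((a + u) * ln (a + u) + (b - u) * ln (b - u) +
       (c - u) * ln (c - u) + (d + u) * ln (d + u))) has_real_derivative
     - (L u / 2) / (1 + exp (L u / 2))\<^sup>2 * (exp (L u / 2) / 2) * S + L u) (at u)"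
    using pos
    by (intro DERIV_add DERIV_chain2[OF dG dL]) (auto intro!: derivative_eq_intros simp: L_def)
  then show ?thesis
    by (simp add: entropy_gap_def Let_def G_def L_def S_def mult.assoc)
qed

lemma entropy_gap_antimono:
  fixes a b c d \<delta> :: real
  assumes pos: "a > 0" "b - \<delta> > 0" "c - \<delta> > 0" "d > 0" and sum: "a + b + c + d = 1"
    and \<delta>: "\<delta> \<ge> 0" and odds: "a * d \<ge> b * c"
  shows "entropy_gap (a + \<delta>) (b - \<delta>) (c - \<delta>) (d + \<delta>) \<le> entropy_gap a b c d"
proof -
  define g where "g = (\<lambda>u. entropy_gap (a + u) (b - u) (c - u) (d + u))"
  have "g \<delta> \<le> g 0"
  proof (rule DERIV_nonpos_imp_nonincreasing[OF \<delta>])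
    fix u assume u: "0 \<le> u" "u \<le> \<delta>"
    define L where "L = ln (a + u) + ln (d + u) - ln (b - u) - ln (c - u)"
    define s where "s = exp (L / 2)"
    define S where "S = 1 / (a + u) + 1 / (b - u) + 1 / (c - u) + 1 / (d + u)"
    have p: "a + u > 0" "b - u > 0" "c - u > 0" "d + u > 0" using pos u by auto
    have eL: "exp L = (a + u) * (d + u) / ((b - u) * (c - u))"
      using p by (simp add: L_def exp_add exp_diff)
    \<comment> \<open>Moving mass to the diagonal keeps the odds-ratio at least 1, so
      \<open>L\<close> stays nonnegative along the whole path.\<close>
    have "(b - u) * (c - u) \<le> b * c" using p u by (intro mult_mono) auto
    also have "\<dots> \<le> (a + u) * (d + u)"
      using odds pos u by (intro order_trans[OF odds] mult_mono) auto
    finally have "1 \<le> exp L" using p by (simp add: eL)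
    then have L: "L \<ge> 0" by simp
    have s: "s \<ge> 1" using L by (simp add: s_def)
    have "s\<^sup>2 = exp L" by (simp add: s_def power2_eq_square flip: exp_add)
    then have "(a + u) * (d + u) = s\<^sup>2 * ((b - u) * (c - u))"
      using p by (simp add: eL)
    then have "4 * (1 + s)\<^sup>2 / s \<le> S"
      unfolding S_def using p s sum by (intro sum_inverse_ge_diagonal) auto
    then have "4 * (1 + s)\<^sup>2 \<le> s * S" using s by (simp add: field_simps)
    \<comment> \<open>A quarter of the right-hand side is the speed of the diagonal table: its entry
      \<open>s / (2 * (1 + s))\<close> has derivative \<open>s / (4 * (1 + s)\<^sup>2)\<close> in
      \<open>L\<close>, and \<open>L\<close> has derivative \<open>S\<close> in
      \<open>u\<close>.\<close>
    then have "4 \<le> s * S / (1 + s)\<^sup>2" using s by (simp add: field_simps)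
    then have "L * (4 - s * S / (1 + s)\<^sup>2) / 4 \<le> 0"
      using L by (intro divide_nonpos_pos mult_nonneg_nonpos) auto
    also have "L * (4 - s * S / (1 + s)\<^sup>2) / 4 = L - L / 2 / (1 + s)\<^sup>2 * (s * S / 2)"
      by (simp add: right_diff_distrib diff_divide_distrib)
    finally have "L - L / 2 / (1 + s)\<^sup>2 * (s * S / 2) \<le> 0" .
    moreover have "(g has_real_derivative L - L / 2 / (1 + s)\<^sup>2 * (s * S / 2)) (at u)"
      using entropy_gap_deriv[OF p] by (simp add: g_def L_def s_def S_def)
    ultimately show "\<exists>y. (g has_real_derivative y) (at u) \<and> y \<le> 0" by blast
  qed
  then show ?thesis by (simp add: g_def)
qed

section \<open>Tables with common margins, ordered by odds-ratio\<close>

lemma same_margins_shift: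
  assumes "t \<in> tables_with_margins r c" "t' \<in> tables_with_margins r c"
  obtains \<delta> where "t'$0$0 = t$0$0 + \<delta>" "t'$0$1 = t$0$1 - \<delta>"
    "t'$1$0 = t$1$0 - \<delta>" "t'$1$1 = t$1$1 + \<delta>"
proof -
  have "row_margin t i = row_margin t' i" "col_margin t i = col_margin t' i" for i
    using assms by (auto simp: tables_with_margins_def)
  note this[of 0] this[of 1]
  then show ?thesis
    by (intro that[of "t'$0$0 - t$0$0"]) (auto simp: row_margin_def col_margin_def)
qed

lemma odds_ratio_shift_mono:
  assumes t: "t \<in> tables" "t' \<in> tables"
    and eqs: "t'$0$0 = t$0$0 + \<delta>" "t'$0$1 = t$0$1 - \<delta>"
      "t'$1$0 = t$1$0 - \<delta>" "t'$1$1 = t$1$1 + \<delta>"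
    and "\<delta> > 0"
  shows "odds_ratio t < odds_ratio t'"
proof -
  have "t$0$0 * t$1$1 < t'$0$0 * t'$1$1"
    using assms by (intro mult_strict_mono) (auto simp: tables_iff)
  moreover have "t'$0$1 * t'$1$0 \<le> t$0$1 * t$1$0"
    using assms by (intro mult_mono) (auto simp: tables_iff)
  ultimately show ?thesis
    using t unfolding odds_ratio_def by (intro frac_less) (auto simp: tables_iff)
qed

lemma odds_ratio_le_shift:
  assumes "t \<in> tables" "t' \<in> tables"
    and "t'$0$0 = t$0$0 + \<delta>" "t'$0$1 = t$0$1 - \<delta>"
      "t'$1$0 = t$1$0 - \<delta>" "t'$1$1 = t$1$1 + \<delta>"
    and "odds_ratio t \<le> odds_ratio t'"
  shows "\<delta> \<ge> 0"
  using odds_ratio_shift_mono[of t' t "- \<delta>"] assms by fastforce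

text \<open>Fixed margins leave one degree of freedom, in which the odds-ratio is strictly monotone.
  This makes any function on such tables a function of the odds-ratio.\<close>

lemma odds_ratio_inj_on_margins: "inj_on odds_ratio (tables_with_margins r c)"
proof (rule inj_onI)
  fix t t' assume t: "t \<in> tables_with_margins r c" "t' \<in> tables_with_margins r c"
    and eq: "odds_ratio t = odds_ratio t'"
  obtain \<delta> where \<delta>: "t'$0$0 = t$0$0 + \<delta>" "t'$0$1 = t$0$1 - \<delta>"
    "t'$1$0 = t$1$0 - \<delta>" "t'$1$1 = t$1$1 + \<delta>"
    using same_margins_shift[OF t] .
  have T: "t \<in> tables" "t' \<in> tables" using t by (auto simp: tables_with_margins_def)
  have "\<delta> \<ge> 0" using odds_ratio_le_shift[OF T \<delta>] eq by simp
  moreover have "- \<delta> \<ge> 0" using odds_ratio_le_shift[OF T(2,1), of "- \<delta>"] \<delta> eq by simp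
  ultimately show "t = t'" using \<delta> by (simp add: table_eq_iff)
qed

lemma diag_entropy_diff_antimono:
  assumes t: "t \<in> tables_with_margins r c" "t' \<in> tables_with_margins r c"
    and "odds_ratio t \<ge> 1" "odds_ratio t \<le> odds_ratio t'"
  shows "diag_entropy t' - table_entropy t' \<le> diag_entropy t - table_entropy t"
proof -
  obtain \<delta> where \<delta>: "t'$0$0 = t$0$0 + \<delta>" "t'$0$1 = t$0$1 - \<delta>"
    "t'$1$0 = t$1$0 - \<delta>" "t'$1$1 = t$1$1 + \<delta>"
    using same_margins_shift[OF t] .
  have T: "t \<in> tables" "t' \<in> tables" using t by (auto simp: tables_with_margins_def)
  have "\<delta> \<ge> 0" using odds_ratio_le_shift[OF T \<delta>] assms by simp
  moreover have "t$0$0 * t$1$1 \<ge> t$0$1 * t$1$0"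
    using assms(3) T by (simp add: odds_ratio_def tables_iff)
  ultimately have "entropy_gap (t'$0$0) (t'$0$1) (t'$1$0) (t'$1$1) \<le>
      entropy_gap (t$0$0) (t$0$1) (t$1$0) (t$1$1)"
    unfolding \<delta> using T \<delta> by (intro entropy_gap_antimono) (auto simp: tables_iff)
  then show ?thesis
    using T by (simp add: diag_entropy_diff divide_right_mono)
qed

section \<open>Monotonicity for odds-ratios at least 1\<close>

lemma yule_Y_sgn:
  assumes "t \<in> tables"
  shows "sgn (yule_Y t) = sgn (odds_ratio t - 1)"
proof -
  have "sqrt (odds_ratio t) + 1 > 0"
    using odds_ratio_pos[OF assms] by (simp add: add_pos_pos)
  then show ?thesis
    by (auto simp: yule_Y_def sgn_if zero_less_divide_iff)
qed

lemma yule_Y_less_one: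
  assumes "t \<in> tables"
  shows "yule_Y t < 1"
  using odds_ratio_pos[OF assms] by (simp add: yule_Y_def divide_less_eq add_pos_pos)

lemma yule_Y_strict_mono:
  assumes "t \<in> tables" "t' \<in> tables" "odds_ratio t < odds_ratio t'"
  shows "yule_Y t < yule_Y t'"
proof -
  define x where "x = sqrt (odds_ratio t)"
  define y where "y = sqrt (odds_ratio t')"
  have "x > 0" "x < y" using assms odds_ratio_pos[OF assms(1)] by (auto simp: x_def y_def)
  then have "(x - 1) / (x + 1) < (y - 1) / (y + 1)" by (simp add: divide_simps) (simp add: algebra_simps)
  then show ?thesis by (simp add: yule_Y_def x_def y_def)
qed

lemma HS_sgn:
  assumes "t \<in> tables"
  shows "sgn (HS n t) = sgn (odds_ratio t - 1)"
proof -
  have "sgn (HS n t) = sgn (yule_Y t)"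
    by (auto simp: HS_def sgn_mult sgn_if)
  then show ?thesis by (simp add: yule_Y_sgn[OF assms])
qed

lemma HS_less_of_one_le:
  assumes n: "n \<ge> 0" and t: "t \<in> tables_with_margins r c" "t' \<in> tables_with_margins r c"
    and odds: "odds_ratio t \<ge> 1" "odds_ratio t < odds_ratio t'"
  shows "HS n t < HS n t'"
proof -
  have T: "t \<in> tables" "t' \<in> tables" using t by (auto simp: tables_with_margins_def)
  define e where "e = exp (n * (diag_entropy t - table_entropy t))"
  define e' where "e' = exp (n * (diag_entropy t' - table_entropy t'))"
  have e: "e' \<le> e" "e' > 0"
    using diag_entropy_diff_antimono[OF t] odds n by (auto simp: e_def e'_def intro!: mult_left_mono)
  have Y: "yule_Y t < yule_Y t'" "yule_Y t' < 1"
    using yule_Y_strict_mono[OF T] yule_Y_less_one[OF T(2)] odds by auto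
  have Y0: "yule_Y t \<ge> 0"
    using yule_Y_sgn[OF T(1)] odds by (auto simp: sgn_if split: if_splits)
  have "HS n t = yule_Y t powr e"
    using Y0 by (simp add: HS_def e_def sgn_if)
  \<comment> \<open>First the exponent drops while the base stays in [0, 1), then the base grows.
    The base may be 0, where both powers are 0; strictness comes from the second step.\<close>
  also have "\<dots> \<le> yule_Y t powr e'"
    using Y Y0 e by (intro powr_mono') auto
  also have "\<dots> < yule_Y t' powr e'"
    using Y Y0 e by (intro powr_less_mono2) auto
  also have "\<dots> = HS n t'"
    using Y Y0 by (simp add: HS_def e'_def sgn_if)
  finally show ?thesis .
qed

section \<open>Exchanging rows or columns, and monotonicity in general\<close>

lemma swap_rows_tables: "t \<in> tables \<Longrightarrow> swap_rows t \<in> tables"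
  and swap_cols_tables: "t \<in> tables \<Longrightarrow> swap_cols t \<in> tables"
  by (auto simp: tables_iff swap_rows_def swap_cols_def)

lemma odds_ratio_swap:
  "odds_ratio (swap_rows t) = 1 / odds_ratio t" "odds_ratio (swap_cols t) = 1 / odds_ratio t"
  by (simp_all add: odds_ratio_def swap_rows_def swap_cols_def mult.commute)

lemma table_entropy_swap:
  "table_entropy (swap_rows t) = table_entropy t" "table_entropy (swap_cols t) = table_entropy t"
  by (simp_all add: table_entropy_def sum_two swap_rows_def swap_cols_def)

text \<open>Exchanges invert the odds-ratio; by this identity they leave the diagonal entropy
  unchanged, so only the sign of \<open>yule_Y\<close> is affected in \<open>HS\<close>.\<close>

lemma diag_table_inverse:
  assumes "l > 0"
  shows "diag_table (1 / l) = swap_rows (diag_table l)"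
  using assms
  by (simp add: table_eq_iff swap_rows_def diag_table_def real_sqrt_divide divide_simps)

lemma yule_Y_inverse:
  assumes "l > 0"
  shows "(sqrt (1 / l) - 1) / (sqrt (1 / l) + 1) = - ((sqrt l - 1) / (sqrt l + 1))"
proof -
  define s where "s = sqrt l"
  have "s > 0" using assms by (simp add: s_def)
  then have "(1 / s - 1) / (1 / s + 1) = - ((s - 1) / (s + 1))"
    by (simp add: divide_simps)
  then show ?thesis by (simp add: s_def real_sqrt_divide)
qed

lemma HS_swap:
  assumes "t \<in> tables"
  shows "HS n (swap_rows t) = - HS n t" "HS n (swap_cols t) = - HS n t"
  using odds_ratio_pos[OF assms]
  by (simp_all add: HS_def yule_Y_def odds_ratio_swap diag_entropy_def diag_table_inverse
      table_entropy_swap yule_Y_inverse sgn_minus)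

lemma swap_rows_margins:
  assumes "t \<in> tables_with_margins r c"
  shows "swap_rows t \<in> tables_with_margins (\<lambda>i. r (1 - i)) c"
  using assms swap_rows_tables[of t]
  by (auto simp: tables_with_margins_def row_margin_def col_margin_def swap_rows_def fun_eq_iff
      add.commute)

lemma HS_strict_mono:
  assumes n: "n \<ge> 0" and t: "t \<in> tables_with_margins r c" "t' \<in> tables_with_margins r c"
    and odds: "odds_ratio t < odds_ratio t'"
  shows "HS n t < HS n t'"
proof -
  have T: "t \<in> tables" "t' \<in> tables" using t by (auto simp: tables_with_margins_def)
  note pos = odds_ratio_pos[OF T(1)] odds_ratio_pos[OF T(2)]
  consider "odds_ratio t \<ge> 1" | "odds_ratio t' \<le> 1" | "odds_ratio t < 1" "odds_ratio t' > 1"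
    by linarith
  then show ?thesis
  proof cases
    case 1
    then show ?thesis using HS_less_of_one_le[OF n t] odds by blast
  next
    case 2
    \<comment> \<open>Inverting the odds-ratios puts them above 1 and reverses their order, so
      \<open>t\<close> and \<open>t'\<close> trade places; both swapped tables again share their
      margins.\<close>
    then have "HS n (swap_rows t') < HS n (swap_rows t)"
      using pos odds
      by (intro HS_less_of_one_le[OF n swap_rows_margins[OF t(2)] swap_rows_margins[OF t(1)]])
        (auto simp: odds_ratio_swap field_simps)
    then show ?thesis by (simp add: HS_swap T)
  next
    case 3
    \<comment> \<open>On opposite sides of 1 the signs alone decide; the exponents need no
      comparison.\<close>
    then have "HS n t < 0" "HS n t' > 0"
      using HS_sgn[OF T(1), of n] HS_sgn[OF T(2), of n] by (auto simp: sgn_if split: if_splits)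
    then show ?thesis by simp
  qed
qed

section \<open>Continuity and the remaining axioms\<close>

text \<open>Splitting into positive and negative parts avoids the discontinuity of \<^const>\<open>sgn\<close>.\<close>

lemma sgn_powr_eq:
  fixes y e :: real
  shows "sgn y * \<bar>y\<bar> powr e = max y 0 powr e - max (- y) 0 powr e"
  by (cases "y > 0"; cases "y = 0") (auto simp: max_def)

lemma HS_continuous: "continuous_on tables (HS n)"
proof -
  have p: "t$0$0 \<noteq> 0" "t$0$1 \<noteq> 0" "t$1$0 \<noteq> 0" "t$1$1 \<noteq> 0" if "t \<in> tables" for t
    using that by (auto simp: tables_iff)
  have cO: "continuous_on tables odds_ratio"
    unfolding odds_ratio_def by (intro continuous_intros) (auto simp: p)
  have q: "sqrt (odds_ratio t) + 1 \<noteq> 0" if "t \<in> tables" for t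
    using odds_ratio_pos[OF that] by (smt (verit) real_sqrt_gt_0_iff)
  have cY: "continuous_on tables yule_Y"
    unfolding yule_Y_def by (intro continuous_intros cO) (auto simp: q)
  have cH: "continuous_on tables table_entropy"
    unfolding table_entropy_eq by (intro continuous_intros) (auto simp: p)
  have "continuous_on tables (\<lambda>t. (ln (2 * (1 + sqrt (odds_ratio t))) -
      sqrt (odds_ratio t) / (1 + sqrt (odds_ratio t)) * ln (sqrt (odds_ratio t))) / ln 2)"
    using q odds_ratio_pos
    by (intro continuous_intros cO)
      (auto simp: add.commute less_imp_neq[symmetric] simp del: distrib_left_numeral)
  then have cD: "continuous_on tables diag_entropy"
    by (rule continuous_on_eq) (simp add: diag_entropy_def diag_table_entropy odds_ratio_pos)
  show ?thesis
    unfolding HS_def sgn_powr_eq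
    \<comment> \<open>At a zero base, continuity of the power requires a positive exponent, which
      \<open>exp\<close> provides.\<close>
    by (intro continuous_intros continuous_on_powr' cY cH cD) auto
qed

lemma HS_transpose: "HS n (transpose t) = HS n t"
proof -
  have "odds_ratio (transpose t) = odds_ratio t"
    by (simp add: odds_ratio_def transpose_def mult.commute)
  moreover have "table_entropy (transpose t) = table_entropy t"
    by (simp add: table_entropy_def sum_two transpose_def)
  ultimately show ?thesis by (simp add: HS_def yule_Y_def diag_entropy_def)
qed

lemma HS_independent:
  assumes "t \<in> tables" "independent_table t"
  shows "HS n t = 0"
proof -
  have "t$i$j = row_margin t i * col_margin t j" for i j
    using assms by (simp add: independent_table_def)
  then have "t$0$0 * t$1$1 = t$0$1 * t$1$0" by (metis mult.commute mult.left_commute)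
  then have "odds_ratio t = 1" using assms by (simp add: odds_ratio_def tables_iff)
  then show ?thesis by (simp add: HS_def yule_Y_def)
qed

theorem mainTheorem12:
  fixes n :: real
  assumes "n \<ge> 0"
  shows "measure_of_association (HS n)"
proof -
  have "\<exists>f. strict_mono_on (odds_ratio ` tables_with_margins r c) f \<and>
      (\<forall>t\<in>tables_with_margins r c. HS n t = f (odds_ratio t))" for r c
  proof (intro exI conjI)
    \<comment> \<open>By injectivity, \<open>?g\<close> recovers the unique table with these margins
      from its odds-ratio.\<close>
    let ?g = "inv_into (tables_with_margins r c) odds_ratio"
    show "\<forall>t\<in>tables_with_margins r c. HS n t = (HS n \<circ> ?g) (odds_ratio t)"
      using odds_ratio_inj_on_margins by simp
    show "strict_mono_on (odds_ratio ` tables_with_margins r c) (HS n \<circ> ?g)"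
      using HS_strict_mono[OF assms] odds_ratio_inj_on_margins[of r c]
      by (auto simp: strict_mono_on_def)
  qed
  then show ?thesis
    by (simp add: measure_of_association_def HS_continuous HS_transpose HS_swap HS_independent)
qed

end
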